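(* Let $(X,f_{1,\infty})$ and $(Y,g_{1,\infty})$ be two NDS such that $f_{1,\infty}$ is topologically semi-conjugate to $g_{1,\infty}$. Then: (i) if $f_{1,\infty}$ is strongly multi-transitive, then $g_{1,\infty}$ is strongly multi-transitive; (ii) for any $p\in\mathbb{N}$ and any vector $\mathbf{a}\in\mathbb{N}^p$, if $f_{1,\infty}$ is multi-transitive with respect to $\mathbf{a}$, then $g_{1,\infty}$ is multi-transitive with respect to $\mathbf{a}$; (iii) if $f_{1,\infty}$ is $\Delta$-mixing, then $g_{1,\infty}$ is $\Delta$-mixing; (iv) if $f_{1,\infty}$ is $\Delta$-transitive, then $g_{1,\infty}$ is $\Delta$-transitive.
   Context: $\mathbb{N}=\{1,2,3,\dots\}$. A non-autonomous discrete dynamical system (NDS) $(X,f_{1,\infty})$ consists of a compact metric space $(X,d)$ and a sequence $f_{1,\infty}=\{f_n\}_{n=1}^\infty$ of continuous maps $f_n:X\to X$. For $i,n\in\mathbb{N}$, $f_i^n:=f_{i+(n-1)}\circ\cdots\circ f_i$, and $f_i^0=\mathrm{id}_X$. $f_{1,\infty}$ is topologically semi-conjugate to $g_{1,\infty}$ if there is a continuous surjection $h:X\to Y$ with $g_n(h(x))=h(f_n(x))$ for all $n\in\mathbb{N}$, $x\in X$. For $k\in\mathbb{N}$, the $k$-th iterate is the NDS on $X$ given by $f_{1,\infty}^{[k]}:=\{f_{k(n-1)+1}^k\}_{n=1}^\infty$ (so the composition of its first $n$ maps is $f_1^{kn}$). Products of NDS are taken termwise. For $\mathbf{a}=(a_1,\dots,a_p)\in\mathbb{N}^p$,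 $f_{1,\infty}^{[\mathbf{a}]}:=f_{1,\infty}^{[a_1]}\times\cdots\times f_{1,\infty}^{[a_p]}$, an NDS on $X^p$. Definitions (for any NDS). Transitive: for any nonempty open $U,V\subseteq X$ there is $n\in\mathbb{N}$ with $f_1^n(U)\cap V\neq\emptyset$. Multi-transitive with respect to $\mathbf{a}\in\mathbb{N}^p$: $(X^p,f_{1,\infty}^{[\mathbf{a}]})$ is transitive. Strongly multi-transitive: multi-transitive with respect to every vector in $\mathbb{N}^p$, for every $p\in\mathbb{N}$. $\Delta$-transitive: for any $m\in\mathbb{N}$ there exists a dense $G_\delta$ subset $D\subset X$ such that for every $x\in D$ the set $\{(f_1^{n}(x),f_1^{2n}(x),\dots,f_1^{mn}(x)) : n\in\mathbb{N}\}$ is dense in $X^m$. $\Delta$-mixing: for each $m\in\mathbb{N}$ and each infinite $A\subset\mathbb{N}$ there exists a dense $G_\delta$ subset $D\subset X$ such that for every $x\in D$ the set $\{(f_1^{n}(x),f_1^{2n}(x),\dots,f_1^{mn}(x)) : n\in A\}$ is dense in $X^m$. *)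

theory Defs
  imports "HOL-Analysis.Abstract_Metric_Spaces"
begin

text \<open>
  A sequence of maps $f_1, f_2, \dots$ is a function on \<open>nat\<close> whose value at \<open>0\<close> is never
  constrained or used.
\<close>

locale NDS = Metric_space X d for X :: "'a set" and d +
  fixes f :: "nat \<Rightarrow> 'a \<Rightarrow> 'a"
  assumes compact: "compact_space mtopology"
    and continuous: "\<And>n. 1 \<le> n \<Longrightarrow> continuous_map mtopology mtopology (f n)"

text \<open>\<open>nds_comp f i n\<close> is $f_i^n = f_{i+(n-1)} \circ \cdots \circ f_i$.\<close>

primrec nds_comp :: "(nat \<Rightarrow> 'a \<Rightarrow> 'a) \<Rightarrow> nat \<Rightarrow> nat \<Rightarrow> 'a \<Rightarrow> 'a" where
  "nds_comp f i 0 = id"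
| "nds_comp f i (Suc n) = f (i + n) \<circ> nds_comp f i n"

definition nds_iterate :: "(nat \<Rightarrow> 'a \<Rightarrow> 'a) \<Rightarrow> nat \<Rightarrow> nat \<Rightarrow> 'a \<Rightarrow> 'a" where
  "nds_iterate f k = (\<lambda>n. nds_comp f (k * (n - 1) + 1) k)"

text \<open>
  Tuples of length \<open>p\<close> over a set \<open>S\<close> are the elements of \<open>{1..p} \<rightarrow>\<^sub>E S\<close>; the space $X^p$ is
  the product topology on them.
\<close>

abbreviation power_topology :: "'a topology \<Rightarrow> nat \<Rightarrow> (nat \<Rightarrow> 'a) topology" where
  "power_topology T p \<equiv> product_topology (\<lambda>_. T) {1..p}"

definition nds_product ::
    "nat \<Rightarrow> (nat \<Rightarrow> nat \<Rightarrow> 'a \<Rightarrow> 'a) \<Rightarrow> nat \<Rightarrow> (nat \<Rightarrow> 'a) \<Rightarrow> nat \<Rightarrow> 'a" where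
  "nds_product p F = (\<lambda>n x. \<lambda>j\<in>{1..p}. F j n (x j))"

definition nds_vector_iterate ::
    "(nat \<Rightarrow> 'a \<Rightarrow> 'a) \<Rightarrow> nat \<Rightarrow> (nat \<Rightarrow> nat) \<Rightarrow> nat \<Rightarrow> (nat \<Rightarrow> 'a) \<Rightarrow> nat \<Rightarrow> 'a" where
  "nds_vector_iterate f p a = nds_product p (\<lambda>j. nds_iterate f (a j))"

definition semi_conjugate ::
    "'a topology \<Rightarrow> (nat \<Rightarrow> 'a \<Rightarrow> 'a) \<Rightarrow> 'b topology \<Rightarrow> (nat \<Rightarrow> 'b \<Rightarrow> 'b) \<Rightarrow> bool" where
  "semi_conjugate S f T g \<longleftrightarrow>
     (\<exists>h. continuous_map S T h \<and> h ` topspace S = topspace T \<and>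
          (\<forall>n\<ge>1. \<forall>x\<in>topspace S. g n (h x) = h (f n x)))"

definition nds_transitive :: "'a topology \<Rightarrow> (nat \<Rightarrow> 'a \<Rightarrow> 'a) \<Rightarrow> bool" where
  "nds_transitive T f \<longleftrightarrow>
     (\<forall>U V. openin T U \<and> U \<noteq> {} \<and> openin T V \<and> V \<noteq> {} \<longrightarrow>
        (\<exists>n\<ge>1. nds_comp f 1 n ` U \<inter> V \<noteq> {}))"

definition multi_transitive ::
    "'a topology \<Rightarrow> (nat \<Rightarrow> 'a \<Rightarrow> 'a) \<Rightarrow> nat \<Rightarrow> (nat \<Rightarrow> nat) \<Rightarrow> bool" where
  "multi_transitive T f p a \<longleftrightarrow>
     nds_transitive (power_topology T p) (nds_vector_iterate f p a)"

definition strongly_multi_transitive :: "'a topology \<Rightarrow> (nat \<Rightarrow> 'a \<Rightarrow> 'a) \<Rightarrow> bool" where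
  "strongly_multi_transitive T f \<longleftrightarrow>
     (\<forall>p\<ge>1. \<forall>a \<in> {1..p} \<rightarrow>\<^sub>E {1..}. multi_transitive T f p a)"

definition dense_in :: "'a topology \<Rightarrow> 'a set \<Rightarrow> bool" where
  "dense_in T S \<longleftrightarrow> S \<subseteq> topspace T \<and> T closure_of S = topspace T"

definition multi_orbit ::
    "(nat \<Rightarrow> 'a \<Rightarrow> 'a) \<Rightarrow> nat \<Rightarrow> nat set \<Rightarrow> 'a \<Rightarrow> (nat \<Rightarrow> 'a) set" where
  "multi_orbit f m A x = (\<lambda>n. \<lambda>j\<in>{1..m}. nds_comp f 1 (j * n) x) ` A"

definition Delta_transitive :: "'a topology \<Rightarrow> (nat \<Rightarrow> 'a \<Rightarrow> 'a) \<Rightarrow> bool" where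
  "Delta_transitive T f \<longleftrightarrow>
     (\<forall>m\<ge>1. \<exists>D. gdelta_in T D \<and> dense_in T D \<and>
        (\<forall>x\<in>D. dense_in (power_topology T m) (multi_orbit f m {1..} x)))"

definition Delta_mixing :: "'a topology \<Rightarrow> (nat \<Rightarrow> 'a \<Rightarrow> 'a) \<Rightarrow> bool" where
  "Delta_mixing T f \<longleftrightarrow>
     (\<forall>m\<ge>1. \<forall>A. A \<subseteq> {1..} \<and> infinite A \<longrightarrow>
        (\<exists>D. gdelta_in T D \<and> dense_in T D \<and>
          (\<forall>x\<in>D. dense_in (power_topology T m) (multi_orbit f m A x))))"

lemma nds_comp_add: "nds_comp f i (m + n) = nds_comp f (i + m) n \<circ> nds_comp f i m"
  by (induction n) (auto simp: fun_eq_iff add.assoc)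

lemma nds_comp_iterate: "nds_comp (nds_iterate f k) 1 n = nds_comp f 1 (k * n)"
proof (induction n)
  case (Suc n)
  have "nds_comp f 1 (k * Suc n) = nds_comp f (1 + k * n) k \<circ> nds_comp f 1 (k * n)"
    using nds_comp_add[of f 1 "k * n" k] by (simp add: add.commute)
  with Suc show ?case
    by (simp add: nds_iterate_def)
qed simp

end

theory Submission imports Defs begin

text \<open>
  A factor map \<open>h\<close> intertwines all compositions, so \<open>h\<close> acting coordinatewise is a factor map of
  the product systems, and preimages of nonempty open sets under it are nonempty and open; this
  gives (i) and (ii). For (iii) and (iv) the image \<open>h ` D\<close> of the given dense
  $G_\delta$ set \<open>D\<close> is dense and consists of points with dense multi-orbits, but it need not be
  $G_\delta$. It is therefore enlarged to the set of all points of \<open>Y\<close> with dense multi-orbit,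
  which is $G_\delta$ because $Y^m$ is second countable.
\<close>

section \<open>Second countability of finite products and of compact metric spaces\<close>

text \<open>Boxes whose sides come from countable bases of the factors form a base. Finiteness of
  \<open>I\<close> makes these boxes open and makes \<open>Pi\<^sub>E I B\<close> countable.\<close>

lemma second_countable_product_topology:
  assumes "finite I" and "\<And>i. i \<in> I \<Longrightarrow> second_countable (X i)"
  shows "second_countable (product_topology X I)"
proof -
  have "\<forall>i\<in>I. \<exists>B. countable B \<and> (\<forall>V \<in> B. openin (X i) V) \<and>
      (\<forall>U x. openin (X i) U \<and> x \<in> U \<longrightarrow> (\<exists>V \<in> B. x \<in> V \<and> V \<subseteq> U))"
    using assms(2) unfolding second_countable_def by blast
  then obtain B where cB: "\<And>i. i \<in> I \<Longrightarrow> countable (B i)"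
    and oB: "\<And>i V. i \<in> I \<Longrightarrow> V \<in> B i \<Longrightarrow> openin (X i) V"
    and bB: "\<And>i U x. i \<in> I \<Longrightarrow> openin (X i) U \<Longrightarrow> x \<in> U \<Longrightarrow> \<exists>V \<in> B i. x \<in> V \<and> V \<subseteq> U"
    by metis
  show ?thesis
    unfolding second_countable_def
  proof (intro exI[of _ "Pi\<^sub>E I ` Pi\<^sub>E I B"] conjI ballI allI impI)
    show "countable (Pi\<^sub>E I ` Pi\<^sub>E I B)"
      using assms(1) cB by (intro countable_image countable_PiE)
  next
    fix V assume "V \<in> Pi\<^sub>E I ` Pi\<^sub>E I B"
    then show "openin (product_topology X I) V"
      using assms(1) oB by (auto simp: openin_PiE_gen PiE_iff)
  next
    fix U x assume "openin (product_topology X I) U \<and> x \<in> U"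
    then obtain W where W: "\<forall>i \<in> I. openin (X i) (W i)" "x \<in> Pi\<^sub>E I W" "Pi\<^sub>E I W \<subseteq> U"
      unfolding openin_product_topology_alt by blast
    have "\<forall>i\<in>I. \<exists>V. V \<in> B i \<and> x i \<in> V \<and> V \<subseteq> W i"
      using W bB by (meson PiE_mem)
    then obtain V where V: "\<And>i. i \<in> I \<Longrightarrow> V i \<in> B i \<and> x i \<in> V i \<and> V i \<subseteq> W i"
      by metis
    \<comment> \<open>The chosen \<open>V\<close> is arbitrary off \<open>I\<close>, while members
      of \<open>Pi\<^sub>E I B\<close> must be extensional; restricting it leaves the box
      unchanged.\<close>
    have "Pi\<^sub>E I (restrict V I) = Pi\<^sub>E I V"
      by (rule PiE_cong) simp
    moreover have "x \<in> Pi\<^sub>E I V"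
      using V W(2) by (auto simp: PiE_iff)
    moreover have "Pi\<^sub>E I V \<subseteq> U"
      using PiE_mono[of I V W] V W(3) by blast
    moreover have "restrict V I \<in> Pi\<^sub>E I B"
      using V by auto
    ultimately show "\<exists>V \<in> Pi\<^sub>E I ` Pi\<^sub>E I B. x \<in> V \<and> V \<subseteq> U"
      by (metis imageI)
  qed
qed

text \<open>Compactness gives total boundedness, hence a finite net for every radius 1/(n+1). The
  balls of these radii around the net points form a countable base.\<close>

lemma (in Metric_space) compact_imp_second_countable:
  assumes "compact_space mtopology"
  shows "second_countable mtopology"
proof -
  have tb: "mtotally_bounded M"
    using assms compactin_imp_mtotally_bounded by (simp add: compact_space_def)
  have "\<forall>n. \<exists>K. finite K \<and> K \<subseteq> M \<and> M \<subseteq> (\<Union>x\<in>K. mball x (inverse (real (Suc n))))"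
    using tb unfolding mtotally_bounded_def by auto
  then obtain K where K: "\<And>n. finite (K n)" "\<And>n. K n \<subseteq> M"
    "\<And>n. M \<subseteq> (\<Union>x\<in>K n. mball x (inverse (real (Suc n))))"
    by metis
  define B where "B = (\<Union>n. (\<lambda>x. mball x (inverse (real (Suc n)))) ` K n)"
  show ?thesis
    unfolding second_countable_def
  proof (intro exI[of _ B] conjI ballI allI impI)
    show "countable B"
      unfolding B_def using K(1) by (simp add: countable_finite)
  next
    fix V assume "V \<in> B"
    then show "openin mtopology V"
      unfolding B_def by auto
  next
    fix U x assume U: "openin mtopology U \<and> x \<in> U"
    then obtain r where r: "r > 0" "mball x r \<subseteq> U"
      unfolding openin_mtopology by blast
    have xM: "x \<in> M"
      using U openin_mtopology by blast
    \<comment> \<open>The base ball containing \<open>x\<close> is centred at a net point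
      \<open>y\<close>, not at \<open>x\<close>. With radius below r/2, any two of its points are
      less than r apart, so it lies in \<open>mball x r\<close>.\<close>
    obtain n where n: "inverse (real (Suc n)) < r / 2"
      using r(1) reals_Archimedean half_gt_zero by blast
    obtain y where y: "y \<in> K n" "x \<in> mball y (inverse (real (Suc n)))"
      using K(3) xM by blast
    have "mball y (inverse (real (Suc n))) \<subseteq> mball x r"
    proof
      fix z assume z: "z \<in> mball y (inverse (real (Suc n)))"
      have "d x z \<le> d y x + d y z"
        using z y(2) triangle''[of y x z] by (simp add: commute triangle)
      then show "z \<in> mball x r"
        using z y(2) n by auto
    qed
    then show "\<exists>V\<in>B. x \<in> V \<and> V \<subseteq> U"
      using y r(2) unfolding B_def by blast
  qed
qed

section \<open>Density, and the G_delta set of points with dense orbit\<close>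

lemma dense_in_iff_intersects:
  "dense_in T S \<longleftrightarrow> S \<subseteq> topspace T \<and> (\<forall>U. openin T U \<and> U \<noteq> {} \<longrightarrow> S \<inter> U \<noteq> {})"
  unfolding dense_in_def dense_intersects_open ..

lemma dense_in_superset:
  assumes "dense_in T S" and "S \<subseteq> S'" and "S' \<subseteq> topspace T"
  shows "dense_in T S'"
  using assms unfolding dense_in_iff_intersects by blast

lemma openin_nonempty_vimage:
  assumes "continuous_map S T h" and "h ` topspace S = topspace T"
    and "openin T V" and "V \<noteq> {}"
  shows "openin S {x \<in> topspace S. h x \<in> V}" and "{x \<in> topspace S. h x \<in> V} \<noteq> {}"
proof -
  show "openin S {x \<in> topspace S. h x \<in> V}"
    using assms openin_continuous_map_preimage by blast
  show "{x \<in> topspace S. h x \<in> V} \<noteq> {}"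
  proof -
    obtain y where "y \<in> V"
      using assms(4) by blast
    moreover from this have "y \<in> h ` topspace S"
      using openin_subset[OF assms(3)] assms(2) by blast
    ultimately show ?thesis
      by blast
  qed
qed

text \<open>Applied twice later: to \<open>h\<close> and the dense set \<open>D\<close>, and to the
  coordinatewise \<open>h\<close> on powers and a dense multi-orbit.\<close>

lemma dense_in_image:
  assumes h: "continuous_map S T h" "h ` topspace S = topspace T" and D: "dense_in S D"
  shows "dense_in T (h ` D)"
  unfolding dense_in_iff_intersects
proof (intro conjI allI impI)
  show "h ` D \<subseteq> topspace T"
    using h D unfolding dense_in_def by blast
next
  fix V assume "openin T V \<and> V \<noteq> {}"
  then have "D \<inter> {x \<in> topspace S. h x \<in> V} \<noteq> {}"
    using openin_nonempty_vimage[OF h] D unfolding dense_in_iff_intersects by meson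
  then show "h ` D \<inter> V \<noteq> {}"
    by blast
qed

text \<open>Density need only be tested on the nonempty members of a countable base of
  \<open>Z\<close>. For each such \<open>V\<close>, the points whose orbit enters \<open>V\<close>
  form a union of preimages, hence an open set. Leaving \<open>\<phi>\<close> abstract lets it later
  be the tuple-valued map that defines a multi-orbit.\<close>

lemma gdelta_in_dense_orbit:
  assumes Z: "second_countable Z"
    and cont: "\<And>n. n \<in> A \<Longrightarrow> continuous_map T Z (\<phi> n)"
  shows "gdelta_in T {y \<in> topspace T. dense_in Z ((\<lambda>n. \<phi> n y) ` A)}"
proof -
  obtain B where B: "countable B" "\<And>V. V \<in> B \<Longrightarrow> openin Z V"
    "\<And>U x. openin Z U \<Longrightarrow> x \<in> U \<Longrightarrow> \<exists>V\<in>B. x \<in> V \<and> V \<subseteq> U"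
    using Z unfolding second_countable_def by metis
  define G where "G V = (\<Union>n\<in>A. {y \<in> topspace T. \<phi> n y \<in> V})" for V
  \<comment> \<open>Including \<open>topspace T\<close> keeps the family nonempty and its
    intersection inside the space even if \<open>B\<close> has no nonempty member.\<close>
  define \<G> where "\<G> = insert (topspace T) (G ` (B - {{}}))"
  have "{y \<in> topspace T. dense_in Z ((\<lambda>n. \<phi> n y) ` A)} = \<Inter>\<G>"
  proof (intro set_eqI iffI)
    fix y assume "y \<in> {y \<in> topspace T. dense_in Z ((\<lambda>n. \<phi> n y) ` A)}"
    then show "y \<in> \<Inter>\<G>"
      using B(2) unfolding \<G>_def G_def dense_in_iff_intersects by fastforce
  next
    fix y assume "y \<in> \<Inter>\<G>"
    then have y: "y \<in> topspace T"
      and hit: "\<And>V. V \<in> B \<Longrightarrow> V \<noteq> {} \<Longrightarrow> \<exists>n\<in>A. \<phi> n y \<in> V"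
      unfolding \<G>_def G_def by auto
    have "dense_in Z ((\<lambda>n. \<phi> n y) ` A)"
      unfolding dense_in_iff_intersects
    proof (intro conjI allI impI)
      show "(\<lambda>n. \<phi> n y) ` A \<subseteq> topspace Z"
        using cont y continuous_map_image_subset_topspace by blast
    next
      fix U assume U: "openin Z U \<and> U \<noteq> {}"
      then obtain V where "V \<in> B" "V \<noteq> {}" "V \<subseteq> U"
        using B(3) by (metis empty_iff equals0I)
      then show "(\<lambda>n. \<phi> n y) ` A \<inter> U \<noteq> {}"
        using hit by blast
    qed
    with y show "y \<in> {y \<in> topspace T. dense_in Z ((\<lambda>n. \<phi> n y) ` A)}"
      by simp
  qed
  moreover have "gdelta_in T (\<Inter>\<G>)"
  proof (rule gdelta_in_Inter)
    show "countable \<G>" "\<G> \<noteq> {}"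
      using B(1) unfolding \<G>_def by auto
  next
    fix S assume "S \<in> \<G>"
    then have "openin T S"
      unfolding \<G>_def G_def using cont B(2)
      by (auto intro!: openin_Union openin_continuous_map_preimage)
    then show "gdelta_in T S"
      by (rule open_imp_gdelta_in)
  qed
  ultimately show ?thesis
    by simp
qed

section \<open>Factor maps, transitivity and products\<close>

text \<open>The intertwining relation is available only on \<open>X\<close>, so invariance of
  \<open>X\<close> is carried through the same induction. A start index \<open>i \<ge> 1\<close>
  keeps every map used away from the unconstrained index 0.\<close>

lemma nds_comp_semi_conjugate:
  assumes "\<And>n. n \<ge> 1 \<Longrightarrow> f n \<in> X \<rightarrow> X" and "\<And>n x. n \<ge> 1 \<Longrightarrow> x \<in> X \<Longrightarrow> g n (h x) = h (f n x)"
    and "i \<ge> 1" and "x \<in> X"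
  shows "nds_comp f i n x \<in> X \<and> nds_comp g i n (h x) = h (nds_comp f i n x)"
proof (induction n)
  case (Suc n)
  then show ?case
    using assms(1)[of "i + n"] assms(2)[of "i + n"] assms(3) by auto
qed (use assms in simp)

lemma continuous_map_nds_comp:
  assumes "\<And>n. n \<ge> 1 \<Longrightarrow> continuous_map T T (f n)" and "i \<ge> 1"
  shows "continuous_map T T (nds_comp f i n)"
proof (induction n)
  case (Suc n)
  then show ?case
    using assms continuous_map_compose by (metis nds_comp.simps(2) trans_le_add1)
qed simp

text \<open>An orbit segment from the preimage of \<open>U\<close> to the preimage of
  \<open>V\<close> projects under \<open>h\<close> to one from \<open>U\<close> to \<open>V\<close>.
  General topologies are allowed so that the result applies to power spaces.\<close>

lemma nds_transitive_semi_conjugate: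
  assumes sc: "semi_conjugate S f T g" and f: "\<And>n. n \<ge> 1 \<Longrightarrow> f n \<in> topspace S \<rightarrow> topspace S"
    and tr: "nds_transitive S f"
  shows "nds_transitive T g"
  unfolding nds_transitive_def
proof (intro allI impI)
  fix U V assume UV: "openin T U \<and> U \<noteq> {} \<and> openin T V \<and> V \<noteq> {}"
  obtain h where h: "continuous_map S T h" "h ` topspace S = topspace T"
    and hfg: "\<And>n x. n \<ge> 1 \<Longrightarrow> x \<in> topspace S \<Longrightarrow> g n (h x) = h (f n x)"
    using sc unfolding semi_conjugate_def by blast
  obtain n where n: "n \<ge> 1"
    and "nds_comp f 1 n ` {x \<in> topspace S. h x \<in> U} \<inter> {x \<in> topspace S. h x \<in> V} \<noteq> {}"
    using tr openin_nonempty_vimage[OF h] UV unfolding nds_transitive_def by meson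
  then obtain x where x: "x \<in> topspace S" "h x \<in> U" "h (nds_comp f 1 n x) \<in> V"
    by blast
  have "nds_comp g 1 n (h x) = h (nds_comp f 1 n x)"
    using nds_comp_semi_conjugate[of f "topspace S" g h 1 x n] f hfg x(1) by simp
  with x n show "\<exists>n\<ge>1. nds_comp g 1 n ` U \<inter> V \<noteq> {}"
    by (metis IntI empty_iff image_eqI)
qed

lemma continuous_map_power:
  assumes "continuous_map S T h"
  shows "continuous_map (power_topology S p) (power_topology T p) (\<lambda>x. \<lambda>j\<in>{1..p}. h (x j))"
  unfolding continuous_map_componentwise
proof (intro conjI ballI)
  fix j assume j: "j \<in> {1..p}"
  have "continuous_map (power_topology S p) T (h \<circ> (\<lambda>x. x j))"
    using continuous_map_compose[OF continuous_map_product_projection[OF j] assms] .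
  with j show "continuous_map (power_topology S p) T (\<lambda>x. (\<lambda>j\<in>{1..p}. h (x j)) j)"
    by (simp add: o_def)
qed auto

lemma surj_power:
  assumes "h ` topspace S = topspace T"
  shows "(\<lambda>x. \<lambda>j\<in>{1..p}. h (x j)) ` topspace (power_topology S p) = topspace (power_topology T p)"
proof (intro subset_antisym subsetI)
  fix y assume "y \<in> topspace (power_topology T p)"
  then have y: "y \<in> {1..p} \<rightarrow>\<^sub>E h ` topspace S"
    using assms by simp
  \<comment> \<open>A preimage is chosen separately in each coordinate.\<close>
  let ?x = "\<lambda>j\<in>{1..p}. inv_into (topspace S) h (y j)"
  have "?x \<in> topspace (power_topology S p)"
    using y by (auto simp: PiE_iff inv_into_into)
  moreover have "y = (\<lambda>j\<in>{1..p}. h (?x j))"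
    using y by (intro ext) (auto simp: PiE_iff f_inv_into_f extensional_def)
  ultimately show "y \<in> (\<lambda>x. \<lambda>j\<in>{1..p}. h (x j)) ` topspace (power_topology S p)"
    by blast
qed (use assms in \<open>auto simp: PiE_iff\<close>)

lemma semi_conjugate_vector_iterate:
  assumes sc: "semi_conjugate S f T g" and f: "\<And>n. n \<ge> 1 \<Longrightarrow> f n \<in> topspace S \<rightarrow> topspace S"
  shows "semi_conjugate (power_topology S p) (nds_vector_iterate f p a)
    (power_topology T p) (nds_vector_iterate g p a)"
proof -
  obtain h where h: "continuous_map S T h" "h ` topspace S = topspace T"
    and hfg: "\<And>n x. n \<ge> 1 \<Longrightarrow> x \<in> topspace S \<Longrightarrow> g n (h x) = h (f n x)"
    using sc unfolding semi_conjugate_def by blast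
  show ?thesis
    unfolding semi_conjugate_def
  proof (intro exI[of _ "\<lambda>x. \<lambda>j\<in>{1..p}. h (x j)"] conjI allI impI ballI)
    fix n :: nat and x :: "nat \<Rightarrow> 'a" assume x: "x \<in> topspace (power_topology S p)"
    \<comment> \<open>The maps of the \<open>a j\<close>-th iterate start at index
      \<open>a j * (n - 1) + 1\<close>, so the relation is needed for every positive start index
      \<open>i\<close>.\<close>
    have "nds_comp g i k (h (x j)) = h (nds_comp f i k (x j))" if "j \<in> {1..p}" "i \<ge> 1" for i j k
      using nds_comp_semi_conjugate[of f "topspace S" g h i "x j" k] f hfg x that
      by (auto simp: PiE_iff)
    then show "nds_vector_iterate g p a n (\<lambda>j\<in>{1..p}. h (x j)) =
        (\<lambda>j\<in>{1..p}. h (nds_vector_iterate f p a n x j))"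
      unfolding nds_vector_iterate_def nds_product_def nds_iterate_def
      by (intro ext) (simp add: restrict_def)
  qed (use continuous_map_power[OF h(1)] surj_power[OF h(2)] in blast)+
qed

lemma multi_transitive_semi_conjugate:
  assumes sc: "semi_conjugate S f T g" and f: "\<And>n. n \<ge> 1 \<Longrightarrow> f n \<in> topspace S \<rightarrow> topspace S"
    and tr: "multi_transitive S f p a"
  shows "multi_transitive T g p a"
  unfolding multi_transitive_def
proof (rule nds_transitive_semi_conjugate)
  show "semi_conjugate (power_topology S p) (nds_vector_iterate f p a)
      (power_topology T p) (nds_vector_iterate g p a)"
    using sc f by (rule semi_conjugate_vector_iterate)
  show "nds_transitive (power_topology S p) (nds_vector_iterate f p a)"
    using tr unfolding multi_transitive_def .
  fix n :: nat
  \<comment> \<open>Semi-conjugating \<open>f\<close> to itself by \<open>id\<close> extracts the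
    invariance half of the lemma.\<close>
  have "nds_comp f i k x \<in> topspace S" if "x \<in> topspace S" "i \<ge> 1" for i k x
    using nds_comp_semi_conjugate[of f "topspace S" f id i x k] f that by simp
  then show "nds_vector_iterate f p a n \<in> topspace (power_topology S p) \<rightarrow> topspace (power_topology S p)"
    unfolding nds_vector_iterate_def nds_product_def nds_iterate_def by (auto simp: PiE_iff)
qed

section \<open>Transfer of dense multi-orbits\<close>

lemma multi_orbit_semi_conjugate:
  assumes "\<And>n. n \<ge> 1 \<Longrightarrow> f n \<in> X \<rightarrow> X" and "\<And>n x. n \<ge> 1 \<Longrightarrow> x \<in> X \<Longrightarrow> g n (h x) = h (f n x)"
    and "x \<in> X"
  shows "multi_orbit g m A (h x) = (\<lambda>x. \<lambda>j\<in>{1..m}. h (x j)) ` multi_orbit f m A x"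
proof -
  have "nds_comp g 1 k (h x) = h (nds_comp f 1 k x)" for k
    using nds_comp_semi_conjugate[of f X g h 1 x k] assms by simp
  then show ?thesis
    unfolding multi_orbit_def image_image by (intro image_cong refl ext) simp
qed

lemma gdelta_in_dense_multi_orbit:
  assumes "second_countable T" and "\<And>n. n \<ge> 1 \<Longrightarrow> continuous_map T T (g n)"
  shows "gdelta_in T {y \<in> topspace T. dense_in (power_topology T m) (multi_orbit g m A y)}"
  unfolding multi_orbit_def
proof (rule gdelta_in_dense_orbit)
  show "second_countable (power_topology T m)"
    using assms(1) by (simp add: second_countable_product_topology)
  show "continuous_map T (power_topology T m) (\<lambda>y. \<lambda>j\<in>{1..m}. nds_comp g 1 (j * n) y)" for n
    using continuous_map_nds_comp[of T g 1, OF assms(2)]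
    by (auto simp: continuous_map_componentwise)
qed

text \<open>Common core of (iii) and (iv): an infinite \<open>A\<close> gives the mixing case,
  \<open>A = {1..}\<close> the transitive one.\<close>

lemma dense_multi_orbits_semi_conjugate:
  assumes sc: "semi_conjugate S f T g" and f: "\<And>n. n \<ge> 1 \<Longrightarrow> f n \<in> topspace S \<rightarrow> topspace S"
    and T: "second_countable T" and g: "\<And>n. n \<ge> 1 \<Longrightarrow> continuous_map T T (g n)"
    and D: "dense_in S D" "\<forall>x\<in>D. dense_in (power_topology S m) (multi_orbit f m A x)"
  shows "\<exists>D. gdelta_in T D \<and> dense_in T D \<and>
    (\<forall>x\<in>D. dense_in (power_topology T m) (multi_orbit g m A x))"
proof -
  obtain h where h: "continuous_map S T h" "h ` topspace S = topspace T"
    and hfg: "\<And>n x. n \<ge> 1 \<Longrightarrow> x \<in> topspace S \<Longrightarrow> g n (h x) = h (f n x)"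
    using sc unfolding semi_conjugate_def by blast
  define E where "E = {y \<in> topspace T. dense_in (power_topology T m) (multi_orbit g m A y)}"
  have "h ` D \<subseteq> E"
  proof
    fix y assume "y \<in> h ` D"
    then obtain x where x: "x \<in> D" "y = h x"
      by blast
    then have xS: "x \<in> topspace S"
      using D(1) unfolding dense_in_def by blast
    have "multi_orbit g m A y = (\<lambda>x. \<lambda>j\<in>{1..m}. h (x j)) ` multi_orbit f m A x"
      unfolding x(2) using f hfg xS by (rule multi_orbit_semi_conjugate)
    \<comment> \<open>The coordinatewise \<open>h\<close> is a continuous surjection between the
      powers, so it carries the dense multi-orbit of \<open>x\<close> to a dense set.\<close>
    then have "dense_in (power_topology T m) (multi_orbit g m A y)"
      using dense_in_image[OF continuous_map_power[OF h(1)] surj_power[OF h(2)]] D(2) x(1) by simp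
    with x xS h(2) show "y \<in> E"
      unfolding E_def by blast
  qed
  then have "dense_in T E"
    using dense_in_superset[OF dense_in_image[OF h D(1)]] unfolding E_def by blast
  moreover have "gdelta_in T E"
    unfolding E_def using T g by (rule gdelta_in_dense_multi_orbit)
  ultimately show ?thesis
    unfolding E_def by blast
qed

theorem theorem7:
  fixes X :: "'a set" and dX :: "'a \<Rightarrow> 'a \<Rightarrow> real" and f :: "nat \<Rightarrow> 'a \<Rightarrow> 'a"
    and Y :: "'b set" and dY :: "'b \<Rightarrow> 'b \<Rightarrow> real" and g :: "nat \<Rightarrow> 'b \<Rightarrow> 'b"
  defines "TX \<equiv> Metric_space.mtopology X dX"
    and "TY \<equiv> Metric_space.mtopology Y dY"
  assumes "NDS X dX f"
    and "NDS Y dY g"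
    and "semi_conjugate TX f TY g"
  shows "(strongly_multi_transitive TX f \<longrightarrow> strongly_multi_transitive TY g) \<and>
    (\<forall>p\<ge>1. \<forall>a \<in> {1..p} \<rightarrow>\<^sub>E {1..}.
       multi_transitive TX f p a \<longrightarrow> multi_transitive TY g p a) \<and>
    (Delta_mixing TX f \<longrightarrow> Delta_mixing TY g) \<and>
    (Delta_transitive TX f \<longrightarrow> Delta_transitive TY g)"
proof -
  interpret F: NDS X dX f by fact
  interpret G: NDS Y dY g by fact
  have f: "f n \<in> topspace TX \<rightarrow> topspace TX" if "n \<ge> 1" for n
    using F.continuous[OF that] unfolding TX_def by (rule continuous_map_funspace)
  have g: "continuous_map TY TY (g n)" if "n \<ge> 1" for n
    using G.continuous[OF that] unfolding TY_def .
  \<comment> \<open>Compactness of \<open>Y\<close> enters here; the G_delta property of the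
    enlarged set rests on it.\<close>
  have TY: "second_countable TY"
    using G.compact_imp_second_countable[OF G.compact] unfolding TY_def .
  note multi = multi_transitive_semi_conjugate[OF assms(5) f]
  note Delta = dense_multi_orbits_semi_conjugate[OF assms(5) f TY g]
  show ?thesis
  proof (intro conjI impI)
    assume "strongly_multi_transitive TX f"
    then show "strongly_multi_transitive TY g"
      unfolding strongly_multi_transitive_def using multi by blast
  next
    show "\<forall>p\<ge>1. \<forall>a \<in> {1..p} \<rightarrow>\<^sub>E {1..}. multi_transitive TX f p a \<longrightarrow> multi_transitive TY g p a"
      using multi by blast
  next
    assume "Delta_mixing TX f"
    then show "Delta_mixing TY g"
      unfolding Delta_mixing_def using Delta by meson
  next
    assume "Delta_transitive TX f"
    then show "Delta_transitive TY g"
      unfolding Delta_transitive_def using Delta by meson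
  qed
qed

end
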